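(* Let $p$ be a prime and let $(w_n)_{n\ge 1}$ be a sequence of positive integers such that $w_n-\log_p(n)$ does not converge to $+\infty$. For each $n$, let $\overline{\mathbf{B}}_n$ be a uniform random element of the set $$\{B\in M_n(\mathbb{F}_p): B(i,j)=0\text{ for all } i,j\text{ such that } |i-j|>w_n\}.$$ Then there is a $\kappa>0$ with the property that for all positive integers $L$, there are infinitely many $n$ such that $$\mathbb{P}(\overline{\mathbf{B}}_n\text{ has an } L\text{-localized kernel})\ge\left(\frac{\kappa}{L}\right)^{4L}.$$ Consequently, for all positive integers $L$, there are infinitely many $n$ such that $$\mathbb{P}(\dim\ker\overline{\mathbf{B}}_n\ge L)\ge\left(\frac{\kappa}{L}\right)^{4L}.$$
   Context: Given positive integers $n$ and $L$, set $n_0=\lfloor n/L\rfloor$, and for $i=1,2,\dots,L$ let $$V_i=\{v\in\mathbb{F}_p^n:\emptyset\ne\operatorname{supp}v\subset[(i-1)n_0+1,\,in_0]\},$$ where $\operatorname{supp} v$ is the set of indices of nonzero coordinates of $v$, and $[c,d]$ denotes the set of integers $\{c,c+1,\dots,d\}$ (empty if $d=c-1$). We say that $\overline{\mathbf{B}}_n$ has an $L$-localized kernel if for all $i=1,2,\dots,L$ there is a $v_i\in V_i$ such that $\overline{\mathbf{B}}_nv_i=0$. Here $\ker\overline{\mathbf{B}}_n=\{v\in\mathbb{F}_p^n:\overline{\mathbf{B}}_nv=0\}$, and $\dim$ is dimension over $\mathbb{F}_p$. *)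

theory Defs
  imports
    "HOL-Probability.Probability_Mass_Function"
    "Berlekamp_Zassenhaus.Finite_Field"
    "Jordan_Normal_Form.Matrix_Kernel"
begin

unbundle no vec_syntax  \<comment> \<open>so that \<open>$\<close> is the entry of a \<^typ>\<open>'a Matrix.vec\<close>\<close>

text \<open>
  The field of \<open>p\<close> elements is \<^typ>\<open>'p mod_ring\<close> for \<open>'p :: prime_card\<close>, with \<open>p = CARD('p)\<close>;
  every prime is the cardinality of such a type.

  Coordinates of vectors and matrices are counted from \<open>0\<close>. The blocks are still numbered
  \<open>1, \<dots>, L\<close>, so the \<open>i\<close>-th block is \<open>{(i - 1) * m..<i * m}\<close> with \<open>m = n div L\<close>.
\<close>

definition band_mats :: "nat \<Rightarrow> nat \<Rightarrow> 'a::zero mat set" where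
  "band_mats n w = {B \<in> carrier_mat n n.
     \<forall>i<n. \<forall>j<n. \<bar>int i - int j\<bar> > int w \<longrightarrow> B $$ (i, j) = 0}"

definition random_band_mat :: "nat \<Rightarrow> nat \<Rightarrow> 'a::{zero,finite} mat pmf" where
  "random_band_mat n w = pmf_of_set (band_mats n w)"

definition supp_vec :: "'a::zero Matrix.vec \<Rightarrow> nat set" where
  "supp_vec v = {j. j < dim_vec v \<and> v $ j \<noteq> 0}"

definition block_vecs :: "nat \<Rightarrow> nat \<Rightarrow> nat \<Rightarrow> 'a::zero Matrix.vec set" where
  "block_vecs n L i = {v \<in> carrier_vec n.
     supp_vec v \<noteq> {} \<and> supp_vec v \<subseteq> {(i - 1) * (n div L)..<i * (n div L)}}"

definition localized_kernel :: "nat \<Rightarrow> nat \<Rightarrow> 'a::semiring_0 mat \<Rightarrow> bool" where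
  "localized_kernel n L B \<longleftrightarrow> (\<forall>i\<in>{1..L}. \<exists>v\<in>block_vecs n L i. B *\<^sub>v v = 0\<^sub>v n)"

text \<open>
  The uniform distribution \<^const>\<open>pmf_of_set\<close> is only meaningful on finite nonempty sets.
\<close>

lemma finite_band_mats: "finite (band_mats n w :: 'a::{zero,finite} mat set)"
proof -
  let ?I = "{..<n} \<times> {..<n}"
  have "carrier_mat n n \<subseteq> (\<lambda>f. mat n n f :: 'a mat) ` (?I \<rightarrow>\<^sub>E UNIV)"
  proof
    fix B :: "'a mat" assume B: "B \<in> carrier_mat n n"
    show "B \<in> (\<lambda>f. mat n n f) ` (?I \<rightarrow>\<^sub>E UNIV)"
    proof (rule image_eqI)
      show "B = mat n n (restrict (\<lambda>ij. B $$ ij) ?I)"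
        using B by (intro eq_matI) auto
    qed auto
  qed
  moreover have "finite (?I \<rightarrow>\<^sub>E (UNIV :: 'a set))"
    by (intro finite_PiE) auto
  ultimately have "finite (carrier_mat n n :: 'a mat set)"
    using finite_surj by blast
  then show ?thesis
    by (rule rev_finite_subset) (auto simp: band_mats_def)
qed

lemma band_mats_nonempty: "band_mats n w \<noteq> {}"
proof -
  have "0\<^sub>m n n \<in> band_mats n w"
    by (auto simp: band_mats_def)
  then show ?thesis by blast
qed

end

theory Submission
  imports Defs "HOL-Real_Asymp.Real_Asymp"
begin

text \<open>
  Process the columns of a stretch of \<open>T\<close> columns one by one, each together with the outermost row
  that it meets. If the current kernel has \<open>N\<close> elements, adding a column
  multiplies this by the field size \<open>q\<close>, and the new row then annihilates everything with
  probability at least \<open>1 / (q N)\<close>, and otherwise divides by at most \<open>q\<close>. So the mean of \<open>N\<close> (capped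
  at \<open>q\<^sup>D\<close>) grows by a constant in each step, and for \<open>T\<close> of order \<open>q\<^sup>D\<close> one has \<open>N \<ge> q\<^sup>D\<close> with
  probability at least \<open>3/4\<close>.

  Inside a block, do this from the left and from the right. The \<open>2 w\<close> rows in the middle are left
  over; fewer than \<open>2 D\<close> of them cannot annihilate all of the \<open>q\<^sup>2\<^sup>D\<close> vectors, and each of the other
  \<open>2 w + 1 - 2 D\<close> rows kills a given vector with probability at least \<open>1 / q\<close>. As \<open>q\<^sup>w\<close> is of order at
  most \<open>n\<close> infinitely often and \<open>q\<^sup>D\<close> is of order \<open>n / L\<close>, this is of order \<open>1 / L\<^sup>2\<close> for one block,
  and distinct blocks are independent because they use disjoint sets of columns.
\<close>

section \<open>Counting subspaces and annihilators\<close>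

definition funs_on :: "'b set \<Rightarrow> ('b \<Rightarrow> 'a::zero) set" where
  "funs_on P = {f. \<forall>x. x \<notin> P \<longrightarrow> f x = 0}"

lemma bij_betw_funs_on:
  "bij_betw (\<lambda>f. restrict f P) (funs_on P :: ('b \<Rightarrow> 'a::zero) set) (P \<rightarrow>\<^sub>E UNIV)"
  by (rule bij_betwI[where g = "\<lambda>h x. if x \<in> P then h x else 0"])
     (auto simp: funs_on_def fun_eq_iff PiE_def extensional_def)

lemma
  assumes "finite P"
  shows finite_funs_on: "finite (funs_on P :: ('b \<Rightarrow> 'a::{zero,finite}) set)"
    and card_funs_on: "card (funs_on P :: ('b \<Rightarrow> 'a::{zero,finite}) set) = CARD('a) ^ card P"
proof -
  have "finite (P \<rightarrow>\<^sub>E (UNIV :: 'a set))" using assms by (intro finite_PiE) auto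
  then show "finite (funs_on P :: ('b \<Rightarrow> 'a) set)"
    using bij_betw_finite[OF bij_betw_funs_on] by blast
  show "card (funs_on P :: ('b \<Rightarrow> 'a) set) = CARD('a) ^ card P"
    using bij_betw_same_card[OF bij_betw_funs_on, of P] assms by (simp add: card_PiE)
qed

lemma card_funs_on_pos:
  assumes "finite P"
  shows "0 < card (funs_on P :: ('b \<Rightarrow> 'a::{zero,finite}) set)"
  using assms by (simp add: card_funs_on card_gt_0_iff)

definition avg :: "'f set \<Rightarrow> ('f \<Rightarrow> real) \<Rightarrow> real" where
  "avg S \<psi> = (\<Sum>f\<in>S. \<psi> f) / real (card S)"

lemma avg_mono: "(\<And>f. f \<in> S \<Longrightarrow> \<psi> f \<le> \<phi> f) \<Longrightarrow> avg S \<psi> \<le> avg S \<phi>"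
  unfolding avg_def by (intro divide_right_mono sum_mono) auto

lemma avg_add: "avg S (\<lambda>f. \<psi> f + \<phi> f) = avg S \<psi> + avg S \<phi>"
  by (simp add: avg_def sum.distrib add_divide_distrib)

lemma avg_cmult: "avg S (\<lambda>f. c * \<psi> f) = c * avg S \<psi>"
  by (simp add: avg_def sum_distrib_left)

lemma avg_multc: "avg S (\<lambda>f. \<psi> f * c) = avg S \<psi> * c"
  by (simp add: avg_def sum_distrib_right)

lemma avg_const: "0 < card S \<Longrightarrow> avg S (\<lambda>_. c) = c"
  by (simp add: avg_def)

lemma avg_of_bool: "finite S \<Longrightarrow> avg S (\<lambda>f. of_bool (Q f)) = card {f\<in>S. Q f} / card S"
  by (simp add: avg_def Int_def)

lemma avg_funs_on_Un:
  fixes \<psi> :: "('b \<Rightarrow> 'a::{monoid_add,finite}) \<Rightarrow> real"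
  assumes "finite A" "finite B" "A \<inter> B = {}"
  shows "avg (funs_on (A \<union> B)) \<psi> =
    avg (funs_on A) (\<lambda>f. avg (funs_on B) (\<lambda>g. \<psi> (\<lambda>x. f x + g x)))"
proof -
  let ?h = "\<lambda>(f, g) x. f x + g x :: 'a"
  have "bij_betw ?h (funs_on A \<times> funs_on B) (funs_on (A \<union> B))"
  proof (rule bij_betwI[where
        g = "\<lambda>h. (\<lambda>x. if x \<in> A then h x else 0, \<lambda>x. if x \<in> B then h x else 0)"], goal_cases)
    case (3 fg)
    then show ?case using assms(3) by (cases fg) (fastforce simp: funs_on_def)
  next
    case (4 f)
    then show ?case using assms(3) by (fastforce simp: funs_on_def)
  qed (auto simp: funs_on_def)
  then have "(\<Sum>f\<in>funs_on A. \<Sum>g\<in>funs_on B. \<psi> (\<lambda>x. f x + g x)) = sum \<psi> (funs_on (A \<union> B))"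
    unfolding sum.cartesian_product using sum.reindex_bij_betw[of ?h _ _ \<psi>]
    by (simp add: case_prod_unfold)
  moreover have "card (funs_on (A \<union> B) :: ('b \<Rightarrow> 'a) set) =
      card (funs_on A :: ('b \<Rightarrow> 'a) set) * card (funs_on B :: ('b \<Rightarrow> 'a) set)"
    using assms by (simp add: card_funs_on card_Un_disjoint power_add)
  ultimately show ?thesis
    unfolding avg_def sum_divide_distrib[symmetric] by (simp add: mult.commute)
qed

lemma card_le_card_fibers:
  assumes "finite Y" "finite N" "h ` G \<subseteq> Y"
    and "\<And>f g. f \<in> G \<Longrightarrow> g \<in> G \<Longrightarrow> h f = h g \<Longrightarrow> (\<lambda>x. f x - g x :: 'a::group_add) \<in> N"
  shows "card G \<le> card Y * card N"
proof -
  have fin: "finite {g\<in>G. h g = y} \<and> card {g\<in>G. h g = y} \<le> card N" for y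
  proof (cases "\<exists>g0\<in>G. h g0 = y")
    case True
    then obtain g0 where g0: "g0 \<in> G" "h g0 = y" by blast
    have "inj_on (\<lambda>g x. g x - g0 x) {g\<in>G. h g = y}"
      by (auto simp: inj_on_def fun_eq_iff diff_eq_eq)
    moreover have "(\<lambda>g x. g x - g0 x) ` {g\<in>G. h g = y} \<subseteq> N"
      using assms(4) g0 by auto
    ultimately show ?thesis
      using assms(2) by (blast intro: card_inj_on_le inj_on_finite)
  next
    case False
    then have *: "{g\<in>G. h g = y} = {}" by auto
    show ?thesis unfolding * by simp
  qed
  have "G = (\<Union>y\<in>Y. {g\<in>G. h g = y})" using assms(3) by auto
  also have "card \<dots> \<le> (\<Sum>y\<in>Y. card {g\<in>G. h g = y})"
    by (rule card_UN_le[OF assms(1)])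
  also have "\<dots> \<le> card Y * card N"
    using sum_bounded_above[of Y "\<lambda>y. card {g\<in>G. h g = y}"] fin by simp
  finally show ?thesis .
qed

definition lin_closed :: "('i \<Rightarrow> 'a::field) set \<Rightarrow> bool" where
  "lin_closed K \<longleftrightarrow> (\<lambda>_. 0) \<in> K \<and> (\<forall>u\<in>K. \<forall>v\<in>K. \<forall>c. (\<lambda>i. u i + c * v i) \<in> K)"

lemma lin_closed_zero: "lin_closed K \<Longrightarrow> (\<lambda>_. 0) \<in> K"
  by (simp add: lin_closed_def)

lemma lin_closed_lin: "lin_closed K \<Longrightarrow> u \<in> K \<Longrightarrow> v \<in> K \<Longrightarrow> (\<lambda>i. u i + c * v i) \<in> K"
  by (simp add: lin_closed_def)

lemma lin_closed_diff:
  assumes "lin_closed K" "u \<in> K" "v \<in> K"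
  shows "(\<lambda>i. u i - v i) \<in> K"
  using lin_closed_lin[OF assms, of "-1"] by simp

lemma lin_closed_scale:
  assumes "lin_closed K" "v \<in> K"
  shows "(\<lambda>i. c * v i) \<in> K"
  using lin_closed_lin[OF assms(1) lin_closed_zero[OF assms(1)] assms(2), of c] by simp

text \<open>
  The induction is on the coordinates: splitting off the vectors that vanish at one coordinate
  divides the cardinality of \<open>K\<close> by the size \<open>q\<close> of the field and leaves one vector more to
  annihilate.
\<close>

lemma card_subspace_annihilator:
  fixes K :: "('i \<Rightarrow> 'a::{field,finite}) set" and G :: "('b \<Rightarrow> 'a) set"
  assumes "finite C" "lin_closed K" "K \<subseteq> funs_on C" "finite G"
    and "\<And>f g. f \<in> G \<Longrightarrow> g \<in> G \<Longrightarrow> (\<lambda>x. f x - g x) \<in> G"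
    and e_diff: "\<And>f g v. e (\<lambda>x. f x - g x) v = (e f v - e g v :: 'a)"
    and e_lin: "\<And>f u v c. e f (\<lambda>i. u i + c * v i) = e f u + c * e f v"
  shows "\<exists>d. card K = CARD('a) ^ d \<and> card G \<le> CARD('a) ^ d * card {g\<in>G. \<forall>v\<in>K. e g v = 0}"
  using assms(1-3)
proof (induction C arbitrary: K)
  case empty
  have "e f (\<lambda>_. 0) = 0" for f
    using e_lin[of f "\<lambda>_. 0" "-1" "\<lambda>_. 0"] by simp
  moreover have "K = {\<lambda>_. 0}"
    using empty by (auto simp: lin_closed_def funs_on_def)
  ultimately show ?case by (auto intro: exI[of _ 0])
next
  case (insert j C)
  define K' where "K' = {v\<in>K. v j = 0}"
  have "lin_closed K'" "K' \<subseteq> funs_on C"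
    using insert.prems by (auto simp: lin_closed_def K'_def funs_on_def)
  from insert.IH[OF this] obtain d where d: "card K' = CARD('a) ^ d"
    "card G \<le> CARD('a) ^ d * card {g\<in>G. \<forall>v\<in>K'. e g v = 0}" by blast
  show ?case
  proof (cases "K' = K")
    case True
    with d show ?thesis by blast
  next
    case False
    then obtain v0 where v0: "v0 \<in> K" "v0 j \<noteq> 0" by (auto simp: K'_def)
    define v1 where "v1 = (\<lambda>i. inverse (v0 j) * v0 i)"
    have v1: "v1 \<in> K" "v1 j = 1"
      using lin_closed_scale[OF insert.prems(1) v0(1)] v0(2) by (auto simp: v1_def)
    have decomp: "(\<lambda>i. v i + (- v j) * v1 i) \<in> K'" if "v \<in> K" for v
      using lin_closed_lin[OF insert.prems(1) that v1(1), of "- v j"] v1(2)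
      unfolding K'_def by simp
    have "bij_betw (\<lambda>(u, c) i. u i + c * v1 i) (K' \<times> UNIV) K"
    proof (rule bij_betwI[where g = "\<lambda>v. (\<lambda>i. v i + (- v j) * v1 i, v j)"])
      show "(\<lambda>(u, c) i. u i + c * v1 i) \<in> K' \<times> UNIV \<rightarrow> K"
        using lin_closed_lin[OF insert.prems(1) _ v1(1)] by (auto simp: K'_def)
      show "(\<lambda>v. (\<lambda>i. v i + (- v j) * v1 i, v j)) \<in> K \<rightarrow> K' \<times> UNIV"
        using decomp by simp
    qed (use v1(2) in \<open>auto simp: K'_def\<close>)
    from bij_betw_same_card[OF this]
    have K: "card K = CARD('a) ^ Suc d" by (simp add: card_cartesian_product d(1) mult.commute)
    let ?A = "{g\<in>G. \<forall>v\<in>K'. e g v = 0}" and ?N = "{g\<in>G. \<forall>v\<in>K. e g v = 0}"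
    have A: "card ?A \<le> card (UNIV :: 'a set) * card {g\<in>?A. e g v1 = 0}"
    proof (rule card_le_card_fibers[where h = "\<lambda>g. e g v1"])
      fix f g assume "f \<in> ?A" "g \<in> ?A" "e f v1 = e g v1"
      then show "(\<lambda>x. f x - g x) \<in> {g\<in>?A. e g v1 = 0}"
        using assms(5)[of f g] e_diff[of f g] by simp
    qed (use assms(4) in auto)
    have "{g\<in>?A. e g v1 = 0} \<subseteq> ?N"
    proof clarify
      fix g v assume g: "g \<in> G" "\<forall>v\<in>K'. e g v = 0" "e g v1 = 0" and v: "v \<in> K"
      from g(2) decomp[OF v] have "e g (\<lambda>i. v i + (- v j) * v1 i) = 0" by blast
      then show "e g v = 0" using g(3) e_lin[of g v "- v j" v1] by simp
    qed
    then have "card {g\<in>?A. e g v1 = 0} \<le> card ?N"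
      using assms(4) by (intro card_mono) auto
    with A have "card ?A \<le> CARD('a) * card ?N"
      using mult_le_mono2 order_trans by blast
    then have "CARD('a) ^ d * card ?A \<le> CARD('a) ^ Suc d * card ?N"
      by (simp add: mult.assoc mult.left_commute)
    with d(2) have "card G \<le> CARD('a) ^ Suc d * card ?N" by (rule order_trans)
    with K show ?thesis by blast
  qed
qed

section \<open>Growth of the kernel of a staircase matrix\<close>

definition block_ker :: "nat set \<Rightarrow> nat set \<Rightarrow> (nat \<times> nat \<Rightarrow> 'a::field) \<Rightarrow> (nat \<Rightarrow> 'a) set" where
  "block_ker C R f = {v \<in> funs_on C. \<forall>r\<in>R. (\<Sum>j\<in>C. f (r, j) * v j) = 0}"

lemma block_ker_cong:
  assumes "\<And>r j. r \<in> R \<Longrightarrow> j \<in> C \<Longrightarrow> f (r, j) = g (r, j)"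
  shows "block_ker C R f = block_ker C R g"
  using assms by (simp add: block_ker_def)

lemma block_ker_insert_row:
  "block_ker C (insert r R) f = {v \<in> block_ker C R f. (\<Sum>j\<in>C. f (r, j) * v j) = 0}"
  by (auto simp: block_ker_def)

lemma block_ker_subset: "block_ker C R f \<subseteq> funs_on C"
  by (auto simp: block_ker_def)

lemma finite_block_ker: "finite C \<Longrightarrow> finite (block_ker C R (f :: _ \<Rightarrow> 'a::{field,finite}))"
  by (simp add: block_ker_def finite_funs_on)

lemma sum_mult_lin:
  fixes a :: "'i \<Rightarrow> 'a::comm_ring"
  shows "(\<Sum>j\<in>C. a j * (u j + c * v j)) = (\<Sum>j\<in>C. a j * u j) + c * (\<Sum>j\<in>C. a j * v j)"
  by (simp add: algebra_simps sum.distrib sum_distrib_left)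

lemma lin_closed_block_ker: "lin_closed (block_ker C R f)"
  by (auto simp: lin_closed_def block_ker_def funs_on_def sum_mult_lin)

lemma card_block_ker_insert_column:
  fixes f :: "nat \<times> nat \<Rightarrow> 'a::{field,finite}"
  assumes "finite C" "c \<notin> C" "\<And>r. r \<in> R \<Longrightarrow> f (r, c) = 0"
  shows "card (block_ker (insert c C) R f) = CARD('a) * card (block_ker C R f)"
proof -
  have upd: "(\<Sum>j\<in>C. f (r, j) * (v(c := x)) j) = (\<Sum>j\<in>C. f (r, j) * v j)" for r v x
    using assms(2) by (intro sum.cong) auto
  have "bij_betw (\<lambda>(x, v). v(c := x)) (UNIV \<times> block_ker C R f) (block_ker (insert c C) R f)"
    by (rule bij_betwI[where g = "\<lambda>v. (v c, v(c := 0))"])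
       (use assms in \<open>auto simp: block_ker_def funs_on_def upd fun_eq_iff simp del: fun_upd_apply,
                     auto simp: fun_upd_def\<close>)
  from bij_betw_same_card[OF this] show ?thesis by (simp add: card_cartesian_product)
qed

lemma card_block_ker_insert_row:
  fixes f :: "nat \<times> nat \<Rightarrow> 'a::{field,finite}"
  assumes "finite C"
  shows "card (block_ker C R f) \<le> CARD('a) * card (block_ker C (insert r R) f)"
proof -
  let ?h = "\<lambda>v. \<Sum>j\<in>C. f (r, j) * v j"
  have "card (block_ker C R f) \<le> card (UNIV :: 'a set) * card (block_ker C (insert r R) f)"
  proof (rule card_le_card_fibers[where h = ?h])
    fix u v assume uv: "u \<in> block_ker C R f" "v \<in> block_ker C R f" "?h u = ?h v"
    then have "?h (\<lambda>i. u i - v i) = 0"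
      by (simp add: algebra_simps sum_subtractf)
    then show "(\<lambda>i. u i - v i) \<in> block_ker C (insert r R) f"
      using lin_closed_diff[OF lin_closed_block_ker uv(1,2)] by (simp add: block_ker_insert_row)
  qed (use assms in \<open>auto simp: finite_block_ker\<close>)
  then show ?thesis by simp
qed

lemma one_div_le_div: "b \<le> a * c \<Longrightarrow> 0 < a \<Longrightarrow> 0 < b \<Longrightarrow> 1 / a \<le> c / b"
  for a b c :: real
  by (simp add: divide_simps mult.commute)

lemma avg_row_annihilates:
  fixes K :: "(nat \<Rightarrow> 'a::{field,finite}) set"
  assumes "finite C" "lin_closed K" "K \<subseteq> funs_on C" "finite (P :: (nat \<times> nat) set)"
  shows "\<exists>d. card K = CARD('a) ^ d \<and>
    1 / card K \<le> avg (funs_on P) (\<lambda>g. of_bool (\<forall>v\<in>K. (\<Sum>j\<in>C. g (r, j) * v j) = 0))"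
proof -
  let ?e = "\<lambda>g v. \<Sum>j\<in>C. g (r, j) * v j :: 'a"
  let ?N = "{g \<in> funs_on P. \<forall>v\<in>K. ?e g v = 0}"
  have "\<exists>d. card K = CARD('a) ^ d \<and> card (funs_on P :: (nat \<times> nat \<Rightarrow> 'a) set) \<le> CARD('a) ^ d * card ?N"
  proof (rule card_subspace_annihilator[OF assms(1-3)])
    show "finite (funs_on P :: (nat \<times> nat \<Rightarrow> 'a) set)" by (rule finite_funs_on[OF assms(4)])
  next
    fix f g :: "nat \<times> nat \<Rightarrow> 'a" and v assume "f \<in> funs_on P" "g \<in> funs_on P"
    then show "(\<lambda>x. f x - g x) \<in> funs_on P" by (simp add: funs_on_def)
  next
    fix f g :: "nat \<times> nat \<Rightarrow> 'a" and v
    show "?e (\<lambda>x. f x - g x) v = ?e f v - ?e g v"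
      by (simp add: left_diff_distrib sum_subtractf)
  qed (rule sum_mult_lin)
  then obtain d where d: "card K = CARD('a) ^ d"
    "card (funs_on P :: (nat \<times> nat \<Rightarrow> 'a) set) \<le> CARD('a) ^ d * card ?N" by blast
  from of_nat_mono[OF d(2)]
  have "real (card (funs_on P :: (nat \<times> nat \<Rightarrow> 'a) set)) \<le> real (card K) * real (card ?N)"
    unfolding d(1) of_nat_mult .
  moreover have "0 < card K" by (simp add: d(1))
  moreover have "0 < card (funs_on P :: (nat \<times> nat \<Rightarrow> 'a) set)" by (rule card_funs_on_pos[OF assms(4)])
  ultimately have "1 / real (card K) \<le> card ?N / card (funs_on P :: (nat \<times> nat \<Rightarrow> 'a) set)"
    by (intro one_div_le_div) simp_all
  then show ?thesis
    unfolding avg_of_bool[OF finite_funs_on[OF assms(4)]] using d(1) by blast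
qed

context
  fixes c \<rho> :: "nat \<Rightarrow> nat" and P :: "(nat \<times> nat) set" and T :: nat
  assumes finP: "finite P" and inj: "inj_on c {..<T}" "inj_on \<rho> {..<T}"
    and notin: "\<And>s t. s < t \<Longrightarrow> t < T \<Longrightarrow> (\<rho> s, c t) \<notin> P"
begin

abbreviation stair_ker where "stair_ker t \<equiv> block_ker (c ` {..<t}) (\<rho> ` {..<t})"
abbreviation stair_plus where "stair_plus t \<equiv> block_ker (c ` {..<Suc t}) (\<rho> ` {..<t})"

lemma card_stair_plus:
  fixes f :: "nat \<times> nat \<Rightarrow> 'a::{field,finite}"
  assumes "f \<in> funs_on P" "t < T"
  shows "card (stair_plus t f) = CARD('a) * card (stair_ker t f)"
proof -
  have "c t \<notin> c ` {..<t}" using inj_on_image_mem_iff[OF inj(1), of t "{..<t}"] assms(2) by auto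
  then show ?thesis unfolding lessThan_Suc image_insert
    using assms notin by (intro card_block_ker_insert_column) (auto simp: funs_on_def)
qed

lemma stair_Suc: "stair_ker (Suc t) f = {v \<in> stair_plus t f. (\<Sum>j\<in>c ` {..<Suc t}. f (\<rho> t, j) * v j) = 0}"
proof -
  have "\<rho> ` {..<Suc t} = insert (\<rho> t) (\<rho> ` {..<t})" by (simp add: lessThan_Suc)
  then show ?thesis by (simp only: block_ker_insert_row)
qed

lemma card_stair_Suc:
  fixes f :: "nat \<times> nat \<Rightarrow> 'a::{field,finite}"
  assumes "f \<in> funs_on P" "t < T"
  shows "card (stair_ker t f) \<le> card (stair_ker (Suc t) f)"
proof -
  have "card (stair_plus t f) \<le> CARD('a) * card (stair_ker (Suc t) f)"
    using card_block_ker_insert_row[of "c ` {..<Suc t}" "\<rho> ` {..<t}" f "\<rho> t"]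
    by (simp add: lessThan_Suc)
  then show ?thesis using card_stair_plus[OF assms] by simp
qed

lemma card_stair_mono:
  fixes f :: "nat \<times> nat \<Rightarrow> 'a::{field,finite}"
  assumes "f \<in> funs_on P" "s \<le> t" "t \<le> T"
  shows "card (stair_ker s f) \<le> card (stair_ker t f)"
  using assms(2,3)
proof (induction t rule: dec_induct)
  case (step t)
  then show ?case using card_stair_Suc[OF assms(1), of t] by simp
qed simp

lemma avg_min_card_stair_Suc:
  fixes D :: nat and M :: real
  defines "M \<equiv> real (CARD('a::{field,finite}) ^ D)"
  assumes t: "t < T"
  shows "avg (funs_on P) (\<lambda>f :: _ \<Rightarrow> 'a. min (card (stair_ker t f)) M) +
      1/2 * avg (funs_on P) (\<lambda>f :: _ \<Rightarrow> 'a. of_bool (card (stair_ker t f) < M))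
    \<le> avg (funs_on P) (\<lambda>f :: _ \<Rightarrow> 'a. min (card (stair_ker (Suc t) f)) M)"
proof -
  define B where "B = {x\<in>P. fst x = \<rho> t}"
  define A where "A = P - B"
  have P: "P = A \<union> B" "finite A" "finite B" "A \<inter> B = {}"
    using finP by (auto simp: A_def B_def)
  let ?q = "CARD('a)"
  have q: "2 \<le> ?q"
    using card_mono[of "UNIV :: 'a set" "{0, 1}"] by simp
  define \<phi> where "\<phi> = (\<lambda>f :: nat \<times> nat \<Rightarrow> 'a. min (card (stair_ker t f)) M + 1/2 * of_bool (card (stair_ker t f) < M))"
  define \<psi> where "\<psi> = (\<lambda>f :: nat \<times> nat \<Rightarrow> 'a. min (card (stair_ker (Suc t) f)) M)"
  have \<rho>t: "\<rho> t \<notin> \<rho> ` {..<t}" using inj_on_image_mem_iff[OF inj(2), of t "{..<t}"] t by auto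
  have inner: "avg (funs_on B) (\<lambda>g. \<phi> (\<lambda>x. f x + g x)) \<le> avg (funs_on B) (\<lambda>g. \<psi> (\<lambda>x. f x + g x))"
    if f: "f \<in> funs_on A" for f
  proof -
    have fP: "f \<in> funs_on P" using f by (auto simp: funs_on_def A_def)
    have agree: "stair_ker t (\<lambda>x. f x + g x) = stair_ker t f" "stair_plus t (\<lambda>x. f x + g x) = stair_plus t f" if "g \<in> funs_on B" for g
    proof -
      have "f (\<rho> s, j) + g (\<rho> s, j) = f (\<rho> s, j)" if "s < t" for s j
      proof -
        have "\<rho> s \<noteq> \<rho> t" using \<rho>t that by (metis imageI lessThan_iff)
        then show ?thesis using \<open>g \<in> funs_on B\<close> by (simp add: funs_on_def B_def)
      qed
      then show "stair_ker t (\<lambda>x. f x + g x) = stair_ker t f" "stair_plus t (\<lambda>x. f x + g x) = stair_plus t f"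
        by (auto intro!: block_ker_cong)
    qed
    have sumP: "(\<lambda>x. f x + g x) \<in> funs_on P" if "g \<in> funs_on B" for g
      using that fP by (auto simp: funs_on_def B_def)
    have f0: "f (\<rho> t, j) = 0" for j using f by (auto simp: funs_on_def A_def B_def)
    have "avg (funs_on B) (\<lambda>g. \<phi> (\<lambda>x. f x + g x)) \<le> avg (funs_on B) (\<lambda>g :: _ \<Rightarrow> 'a. \<phi> f)"
      by (rule avg_mono) (simp add: \<phi>_def agree)
    also have "\<dots> = \<phi> f" using P(3) by (intro avg_const card_funs_on_pos)
    also have "\<phi> f \<le> avg (funs_on B) (\<lambda>g. \<psi> (\<lambda>x. f x + g x))"
    proof (cases "card (stair_ker t f) < M")
      case False
      have "avg (funs_on B) (\<lambda>g :: _ \<Rightarrow> 'a. M) \<le> avg (funs_on B) (\<lambda>g. \<psi> (\<lambda>x. f x + g x))"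
      proof (rule avg_mono)
        fix g :: "nat \<times> nat \<Rightarrow> 'a" assume g: "g \<in> funs_on B"
        from card_stair_Suc[OF sumP[OF g] t] agree[OF g] False
        show "M \<le> \<psi> (\<lambda>x. f x + g x)" by (simp add: \<psi>_def)
      qed
      also have "avg (funs_on B) (\<lambda>g :: _ \<Rightarrow> 'a. M) = M"
        using P(3) by (intro avg_const card_funs_on_pos)
      finally show ?thesis using False by (simp add: \<phi>_def)
    next
      case True
      have fin: "finite (c ` {..<t})" "finite (c ` {..<Suc t})" by simp_all
      from avg_row_annihilates[OF fin(1) lin_closed_block_ker block_ker_subset finite.emptyI,
          of "\<rho> ` {..<t}" f]
      obtain d where d: "card (stair_ker t f) = ?q ^ d" by blast
      define kills where
        "kills g \<longleftrightarrow> (\<forall>v\<in>stair_plus t f. (\<Sum>j\<in>c ` {..<Suc t}. g (\<rho> t, j) * v j) = 0)" for g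
      have card': "card (stair_plus t f) = ?q ^ Suc d" using card_stair_plus[OF fP t] d by simp
      have avg_kills: "1 / real (?q ^ Suc d) \<le> avg (funs_on B) (\<lambda>g. of_bool (kills g))"
        using avg_row_annihilates[OF fin(2) lin_closed_block_ker block_ker_subset P(3),
            of "\<rho> ` {..<t}" f "\<rho> t"]
        unfolding kills_def card' by blast
      have "?q ^ d < ?q ^ D" using True unfolding d M_def by (simp only: of_nat_less_iff)
      then have "d < D" using q by (simp add: power_strict_increasing_iff)
      then have le: "real (?q ^ Suc d) \<le> M" unfolding M_def
        using q by (intro of_nat_mono power_increasing) auto
      have "avg (funs_on B) (\<lambda>g. real (?q ^ d) + (real (?q ^ Suc d) - real (?q ^ d)) * of_bool (kills g))
        \<le> avg (funs_on B) (\<lambda>g. \<psi> (\<lambda>x. f x + g x))"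
      proof (rule avg_mono)
        fix g :: "nat \<times> nat \<Rightarrow> 'a" assume g: "g \<in> funs_on B"
        have "real (?q ^ d) \<le> card (stair_ker (Suc t) (\<lambda>x. f x + g x))"
          using card_stair_Suc[OF sumP[OF g] t] agree[OF g] d by simp
        moreover have "real (?q ^ Suc d) = card (stair_ker (Suc t) (\<lambda>x. f x + g x))" if "kills g"
        proof -
          have "stair_ker (Suc t) (\<lambda>x. f x + g x) = stair_plus t f"
            unfolding stair_Suc agree[OF g] using that by (auto simp: f0 kills_def)
          then show ?thesis using card' by simp
        qed
        moreover have "real (?q ^ d) \<le> M"
          using \<open>?q ^ d < ?q ^ D\<close> unfolding M_def by (intro of_nat_mono) simp
        ultimately show "real (?q ^ d) + (real (?q ^ Suc d) - real (?q ^ d)) * of_bool (kills g) \<le> \<psi> (\<lambda>x. f x + g x)"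
          using le by (cases "kills g") (simp_all add: \<psi>_def)
      qed
      also have "avg (funs_on B) (\<lambda>g. real (?q ^ d) + (real (?q ^ Suc d) - real (?q ^ d)) * of_bool (kills g))
        = real (?q ^ d) + (real (?q ^ Suc d) - real (?q ^ d)) * avg (funs_on B) (\<lambda>g. of_bool (kills g))"
        using avg_const[OF card_funs_on_pos[OF P(3)]] by (simp add: avg_add avg_cmult)
      finally have "real (?q ^ d) + (real (?q ^ Suc d) - real (?q ^ d)) * avg (funs_on B) (\<lambda>g. of_bool (kills g))
        \<le> avg (funs_on B) (\<lambda>g. \<psi> (\<lambda>x. f x + g x))" .
      moreover have "(real (?q ^ Suc d) - real (?q ^ d)) * (1 / real (?q ^ Suc d))
        \<le> (real (?q ^ Suc d) - real (?q ^ d)) * avg (funs_on B) (\<lambda>g. of_bool (kills g))"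
        using q by (intro mult_left_mono avg_kills) simp
      moreover have "1/2 \<le> (real (?q ^ Suc d) - real (?q ^ d)) * (1 / real (?q ^ Suc d))"
        using q by (simp add: field_simps)
      moreover have "\<phi> f = real (?q ^ d) + 1/2" using True d by (simp add: \<phi>_def)
      ultimately show ?thesis by linarith
    qed
    finally show ?thesis .
  qed
  have "avg (funs_on (A \<union> B)) \<phi> \<le> avg (funs_on (A \<union> B)) \<psi>"
    unfolding avg_funs_on_Un[OF P(2-4)] by (rule avg_mono) (rule inner)
  then show ?thesis unfolding P(1)[symmetric] \<phi>_def \<psi>_def avg_add avg_cmult .
qed

lemma avg_card_stair_less:
  "T * avg (funs_on P :: (nat \<times> nat \<Rightarrow> 'a::{field,finite}) set) (\<lambda>f. of_bool (card (stair_ker T f) < CARD('a) ^ D))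
    \<le> 2 * CARD('a) ^ D"
proof -
  let ?F = "funs_on P :: (nat \<times> nat \<Rightarrow> 'a) set" and ?M = "real (CARD('a) ^ D)"
  let ?p = "avg ?F (\<lambda>f. of_bool (card (stair_ker T f) < ?M))"
  have "t / 2 * ?p \<le> avg ?F (\<lambda>f. min (card (stair_ker t f)) ?M)" if "t \<le> T" for t
    using that
  proof (induction t)
    case 0
    have "avg ?F (\<lambda>_. 0) \<le> avg ?F (\<lambda>f. min (card (stair_ker 0 f)) ?M)"
      by (rule avg_mono) simp
    then show ?case by (simp add: avg_def)
  next
    case (Suc t)
    have "?p \<le> avg ?F (\<lambda>f. of_bool (card (stair_ker t f) < ?M))"
    proof (rule avg_mono)
      fix f assume "f \<in> ?F"
      from card_stair_mono[OF this, of t T] Suc.prems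
      show "of_bool (card (stair_ker T f) < ?M) \<le> (of_bool (card (stair_ker t f) < ?M) :: real)"
        by (auto simp del: of_nat_power)
    qed
    moreover have "t / 2 * ?p \<le> avg ?F (\<lambda>f. min (card (stair_ker t f)) ?M)"
      using Suc by simp
    moreover have "real (Suc t) / 2 * ?p = t / 2 * ?p + 1 / 2 * ?p"
      by (simp add: field_simps)
    ultimately show ?case
      using avg_min_card_stair_Suc[of t D, where 'a = 'a] Suc.prems by linarith
  qed
  from this[of T] have "T / 2 * ?p \<le> avg ?F (\<lambda>f. min (card (stair_ker T f)) ?M)" by simp
  also have "\<dots> \<le> avg ?F (\<lambda>f. ?M)" by (rule avg_mono) simp
  also have "\<dots> = ?M" by (intro avg_const card_funs_on_pos finP)
  finally show ?thesis by simp
qed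

end

section \<open>Kernel vectors supported in blocks\<close>

lemma block_ker_mono_columns:
  assumes "finite C'" "C \<subseteq> C'"
  shows "block_ker C R f \<subseteq> block_ker C' R f"
proof
  fix v assume v: "v \<in> block_ker C R f"
  then have "v j = 0" if "j \<notin> C" for j using that by (simp add: block_ker_def funs_on_def)
  then have "(\<Sum>j\<in>C'. f (r, j) * v j) = (\<Sum>j\<in>C. f (r, j) * v j)" for r
    using assms by (intro sum.mono_neutral_right) auto
  then show "v \<in> block_ker C' R f"
    using v assms(2) unfolding block_ker_def funs_on_def by auto
qed

lemma avg_rows_annihilate_vector:
  fixes v :: "nat \<Rightarrow> 'a::{field,finite}"
  assumes "finite (B :: (nat \<times> nat) set)" "finite R"
  shows "1 / real (CARD('a) ^ card R)
    \<le> avg (funs_on B) (\<lambda>g. of_bool (\<forall>r\<in>R. (\<Sum>j\<in>C. g (r, j) * v j) = 0))"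
proof -
  let ?G = "funs_on B :: (nat \<times> nat \<Rightarrow> 'a) set"
  let ?N = "{g\<in>?G. \<forall>r\<in>R. (\<Sum>j\<in>C. g (r, j) * v j) = 0}"
  let ?h = "\<lambda>g r. if r \<in> R then \<Sum>j\<in>C. g (r, j) * v j else 0"
  have fin: "finite ?G" by (rule finite_funs_on[OF assms(1)])
  have "card ?G \<le> card (funs_on R :: (nat \<Rightarrow> 'a) set) * card ?N"
  proof (rule card_le_card_fibers[where h = ?h])
    show "finite (funs_on R :: (nat \<Rightarrow> 'a) set)" by (rule finite_funs_on[OF assms(2)])
    show "finite ?N" using fin by simp
    show "?h ` ?G \<subseteq> funs_on R" by (auto simp: funs_on_def)
  next
    fix f g assume fg: "f \<in> ?G" "g \<in> ?G" "?h f = ?h g"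
    have "(\<Sum>j\<in>C. (f (r, j) - g (r, j)) * v j) = 0" if "r \<in> R" for r
      using fun_cong[OF fg(3), of r] that by (simp add: left_diff_distrib sum_subtractf)
    then show "(\<lambda>x. f x - g x) \<in> ?N" using fg(1,2) by (simp add: funs_on_def)
  qed
  from of_nat_mono[OF this]
  have "real (card ?G) \<le> real (CARD('a) ^ card R) * real (card ?N)"
    unfolding card_funs_on[OF assms(2)] of_nat_mult .
  then have "1 / real (CARD('a) ^ card R) \<le> real (card ?N) / real (card ?G)"
    using card_funs_on_pos[OF assms(1), where 'a = 'a] by (intro one_div_le_div) simp_all
  then show ?thesis unfolding avg_of_bool[OF fin] .
qed

definition has_block_kernel :: "nat set \<Rightarrow> (nat \<times> nat \<Rightarrow> 'a::field) \<Rightarrow> bool" where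
  "has_block_kernel C f \<longleftrightarrow> (\<exists>v\<in>block_ker C UNIV f. v \<noteq> (\<lambda>_. 0))"

definition band :: "nat \<Rightarrow> (nat \<times> nat) set" where
  "band w = {(r, j). r \<le> j + w \<and> j \<le> r + w}"

text \<open>
  The left vectors do not meet the right rows and vice versa, so sums of the two kinds are killed
  by all outer rows; there are at least \<open>q\<^sup>2\<^sup>D\<close> of them, hence fewer than \<open>2D\<close> further rows cannot
  separate them.
\<close>

lemma glue_kernels:
  fixes f :: "nat \<times> nat \<Rightarrow> 'a::{field,finite}"
  assumes f: "f \<in> funs_on (band w)" and "w \<le> a" "s < 2 * D"
    and L: "CARD('a) ^ D \<le> card (block_ker {a..<a + T} {a - w..<a - w + T} f)" (is "_ \<le> card ?KL")
    and R: "CARD('a) ^ D \<le> card (block_ker {a + T..<a + 2 * T} {a + T + w..<a + 2 * T + w} f)" (is "_ \<le> card ?KR")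
  obtains v where "v \<noteq> (\<lambda>_. 0)"
    "v \<in> block_ker {a..<a + 2 * T} (- {a - w + T + s..<a + T + w}) f"
proof -
  let ?CL = "{a..<a + T}" and ?CR = "{a + T..<a + 2 * T}" and ?C = "{a..<a + 2 * T}"
  let ?Ra = "{a - w + T..<a - w + T + s}"
  let ?\<Phi> = "\<lambda>(u, v) r. if r \<in> ?Ra then \<Sum>j\<in>?C. f (r, j) * (u j + v j) else 0 :: 'a"
  have q: "1 < CARD('a)"
    using card_mono[of "UNIV :: 'a set" "{0, 1}"] by simp
  have "?\<Phi> ` (?KL \<times> ?KR) \<subseteq> funs_on ?Ra" by (auto simp: funs_on_def)
  then have "card (?\<Phi> ` (?KL \<times> ?KR)) \<le> card (funs_on ?Ra :: (nat \<Rightarrow> 'a) set)"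
    by (intro card_mono finite_funs_on) auto
  also have "\<dots> = CARD('a) ^ s" by (simp add: card_funs_on)
  also have "\<dots> < CARD('a) ^ (2 * D)" using q assms(3) by (rule power_strict_increasing[rotated])
  also have "\<dots> = CARD('a) ^ D * CARD('a) ^ D" by (simp add: mult_2 power_add)
  also have "\<dots> \<le> card (?KL \<times> ?KR)" unfolding card_cartesian_product by (rule mult_le_mono[OF L R])
  finally have "\<not> inj_on ?\<Phi> (?KL \<times> ?KR)" using pigeonhole by blast
  then obtain u v u' v' where uv: "u \<in> ?KL" "u' \<in> ?KL" "v \<in> ?KR" "v' \<in> ?KR"
    "?\<Phi> (u, v) = ?\<Phi> (u', v')" "(u, v) \<noteq> (u', v')"
    unfolding inj_on_def by blast
  define d1 where "d1 = (\<lambda>j. u j - u' j)"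
  define d2 where "d2 = (\<lambda>j. v j - v' j)"
  have d1: "d1 \<in> ?KL" unfolding d1_def by (rule lin_closed_diff[OF lin_closed_block_ker uv(1,2)])
  have d2: "d2 \<in> ?KR" unfolding d2_def by (rule lin_closed_diff[OF lin_closed_block_ker uv(3,4)])
  have d1_0: "d1 j = 0" if "j \<notin> ?CL" for j
    using d1 that unfolding block_ker_def funs_on_def by blast
  have d2_0: "d2 j = 0" if "j \<notin> ?CR" for j
    using d2 that unfolding block_ker_def funs_on_def by blast
  define z where "z = (\<lambda>j. d1 j + d2 j)"
  have "z \<noteq> (\<lambda>_. 0)"
  proof
    assume z0: "z = (\<lambda>_. 0)"
    have "d1 j = 0 \<and> d2 j = 0" for j
      using fun_cong[OF z0, of j] d1_0[of j] d2_0[of j] unfolding z_def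
      by (cases "j \<in> ?CL") auto
    then have "u = u'" "v = v'" unfolding d1_def d2_def by (auto simp: fun_eq_iff)
    with uv(6) show False by simp
  qed
  have band0: "f (r, j) = 0" if "r > j + w \<or> j > r + w" for r j
    using f that unfolding funs_on_def band_def by auto
  have split: "(\<Sum>j\<in>?C. f (r, j) * z j) = (\<Sum>j\<in>?CL. f (r, j) * d1 j) + (\<Sum>j\<in>?CR. f (r, j) * d2 j)" for r
  proof -
    have "(\<Sum>j\<in>?C. f (r, j) * z j) = (\<Sum>j\<in>?C. f (r, j) * d1 j) + (\<Sum>j\<in>?C. f (r, j) * d2 j)"
      unfolding z_def by (simp add: distrib_left sum.distrib)
    also have "(\<Sum>j\<in>?C. f (r, j) * d1 j) = (\<Sum>j\<in>?CL. f (r, j) * d1 j)"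
      by (intro sum.mono_neutral_right) (auto simp: d1_0)
    also have "(\<Sum>j\<in>?C. f (r, j) * d2 j) = (\<Sum>j\<in>?CR. f (r, j) * d2 j)"
      by (intro sum.mono_neutral_right) (auto simp: d2_0)
    finally show ?thesis .
  qed
  have "(\<Sum>j\<in>?C. f (r, j) * z j) = 0" if r: "r \<notin> {a - w + T + s..<a + T + w}" for r
  proof (cases "r \<in> ?Ra")
    case True
    have "(\<Sum>j\<in>?C. f (r, j) * (u j + v j)) = (\<Sum>j\<in>?C. f (r, j) * (u' j + v' j))"
      using fun_cong[OF uv(5), of r] True by simp
    then have "(\<Sum>j\<in>?C. f (r, j) * (u j + v j) - f (r, j) * (u' j + v' j)) = 0"
      by (simp add: sum_subtractf)
    then show ?thesis unfolding z_def d1_def d2_def by (simp add: algebra_simps)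
  next
    case False
    have "(\<Sum>j\<in>?CL. f (r, j) * d1 j) = 0"
    proof (cases "r \<in> {a - w..<a - w + T}")
      case True
      then show ?thesis using d1 unfolding block_ker_def by blast
    next
      case out: False
      have "f (r, j) = 0" if "j \<in> ?CL" for j
        using that out False r \<open>w \<le> a\<close> by (intro band0) (simp, linarith)
      then show ?thesis by simp
    qed
    moreover have "(\<Sum>j\<in>?CR. f (r, j) * d2 j) = 0"
    proof (cases "r \<in> {a + T + w..<a + 2 * T + w}")
      case True
      then show ?thesis using d2 unfolding block_ker_def by blast
    next
      case out: False
      have "f (r, j) = 0" if "j \<in> ?CR" for j
        using that out False r \<open>w \<le> a\<close> by (intro band0) (simp, linarith)
      then show ?thesis by simp
    qed
    ultimately show ?thesis using split by simp
  qed
  moreover have "z \<in> funs_on ?C"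
  proof -
    have "d1 j + d2 j = 0" if "j \<notin> ?C" for j
    proof -
      have "j \<notin> ?CL" "j \<notin> ?CR" using that by auto
      then show ?thesis using d1_0[of j] d2_0[of j] by simp
    qed
    then show ?thesis unfolding funs_on_def z_def by blast
  qed
  ultimately have "z \<in> block_ker ?C (- {a - w + T + s..<a + T + w}) f"
    unfolding block_ker_def by blast
  with \<open>z \<noteq> (\<lambda>_. 0)\<close> show ?thesis by (rule that)
qed

lemma avg_has_block_kernel:
  assumes P: "finite P" "P \<subseteq> band w" and "w \<le> a" "1 \<le> D" "8 * CARD('a) ^ D \<le> T"
  shows "1 / 2 * (1 / real (CARD('a) ^ (2 * w + 1 - 2 * D)))
    \<le> avg (funs_on P) (\<lambda>f :: _ \<Rightarrow> 'a::{field,finite}. of_bool (has_block_kernel {a..<a + 2 * T} f))"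
proof -
  define s where "s = min (2 * D - 1) (2 * w)"
  let ?Rb = "{a - w + T + s..<a + T + w}" and ?C = "{a..<a + 2 * T}"
  define B where "B = {x\<in>P. fst x \<in> ?Rb}"
  define A where "A = P - B"
  have AB: "A \<union> B = P" "finite A" "finite B" "A \<inter> B = {}" "A \<subseteq> band w"
    using P by (auto simp: A_def B_def)
  let ?FA = "funs_on A :: (nat \<times> nat \<Rightarrow> 'a) set" and ?FB = "funs_on B :: (nat \<times> nat \<Rightarrow> 'a) set"
  have q: "1 < CARD('a)"
    using card_mono[of "UNIV :: 'a set" "{0, 1}"] by simp
  have T: "0 < T" using assms(5) q by (metis gr0I le_zero_eq mult_is_0 power_eq_0_iff zero_neq_numeral not_one_less_zero)
  let ?lowL = "\<lambda>f :: _ \<Rightarrow> 'a. card (block_ker {a..<a + T} {a - w..<a - w + T} f) < CARD('a) ^ D"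
  let ?lowR = "\<lambda>f :: _ \<Rightarrow> 'a. card (block_ker {a + T..<a + 2 * T} {a + T + w..<a + 2 * T + w} f) < CARD('a) ^ D"
  have quarter: "p \<le> 1 / 4" if "T * p \<le> real (2 * CARD('a) ^ D)" for p :: real
  proof -
    have "real (8 * CARD('a) ^ D) \<le> T" using assms(5) by (rule of_nat_mono)
    then have "T * p \<le> T * (1 / 4)" using that by simp
    then show ?thesis using T by (subst (asm) mult_le_cancel_left_pos) simp_all
  qed
  have lowL: "avg ?FA (\<lambda>f. of_bool (?lowL f)) \<le> 1 / 4"
  proof (rule quarter)
    have im: "(\<lambda>t. a + t) ` {..<T} = {a..<a + T}" "(\<lambda>t. a - w + t) ` {..<T} = {a - w..<a - w + T}"
      unfolding lessThan_atLeast0 image_add_atLeastLessThan by (simp_all add: add.commute)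
    have "(a - w + s, a + t) \<notin> A" if "s < t" for s t
      using AB(5) that \<open>w \<le> a\<close> unfolding band_def by auto
    from avg_card_stair_less[where c = "\<lambda>t. a + t" and \<rho> = "\<lambda>s. a - w + s" and D = D and 'a = 'a,
        OF AB(2) _ _ this, of T]
    show "T * avg ?FA (\<lambda>f. of_bool (?lowL f)) \<le> real (2 * CARD('a) ^ D)"
      unfolding im by simp
  qed
  have lowR: "avg ?FA (\<lambda>f. of_bool (?lowR f)) \<le> 1 / 4"
  proof (rule quarter)
    have im: "(\<lambda>t. c + T - 1 - t) ` {..<T} = {c..<c + T}" for c
    proof -
      have "j \<in> (\<lambda>t. c + T - 1 - t) ` {..<T}" if "j \<in> {c..<c + T}" for j
        using that by (intro image_eqI[of _ _ "c + T - 1 - j"]) auto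
      then show ?thesis by auto
    qed
    have im': "(\<lambda>t. a + T + T - 1 - t) ` {..<T} = {a + T..<a + 2 * T}"
      "(\<lambda>t. a + T + w + T - 1 - t) ` {..<T} = {a + T + w..<a + 2 * T + w}"
      unfolding im by (simp_all add: mult_2 add_ac)
    have "(a + T + w + T - 1 - s, a + T + T - 1 - t) \<notin> A" if "s < t" "t < T" for s t
      using AB(5) that unfolding band_def by auto
    moreover have "inj_on (\<lambda>t. c + T - 1 - t) {..<T}" for c
      by (auto simp: inj_on_def)
    ultimately have "T * avg ?FA (\<lambda>f. of_bool (card (block_ker
          ((\<lambda>t. a + T + T - 1 - t) ` {..<T}) ((\<lambda>t. a + T + w + T - 1 - t) ` {..<T}) f) < CARD('a) ^ D))
        \<le> real (2 * CARD('a) ^ D)"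
      by (intro avg_card_stair_less AB(2))
    then show "T * avg ?FA (\<lambda>f. of_bool (?lowR f)) \<le> real (2 * CARD('a) ^ D)"
      unfolding im' .
  qed
  let ?p = "1 / real (CARD('a) ^ (2 * w + 1 - 2 * D))"
  have p0: "0 \<le> ?p" by simp
  have inner: "(1 - of_bool (?lowL f) - of_bool (?lowR f)) * ?p
      \<le> avg ?FB (\<lambda>g. of_bool (has_block_kernel ?C (\<lambda>x. f x + g x)))" if f: "f \<in> ?FA" for f
  proof (cases "?lowL f \<or> ?lowR f")
    case True
    have "(1 - of_bool (?lowL f) - of_bool (?lowR f)) * ?p \<le> 0"
      using True p0 by (intro mult_nonpos_nonneg) auto
    also have "0 \<le> avg ?FB (\<lambda>g. of_bool (has_block_kernel ?C (\<lambda>x. f x + g x)))"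
      unfolding avg_def by (intro divide_nonneg_nonneg sum_nonneg) auto
    finally show ?thesis .
  next
    case False
    have f': "f \<in> funs_on (band w)" using f AB(5) unfolding funs_on_def by blast
    have "s < 2 * D" using \<open>1 \<le> D\<close> by (simp add: s_def)
    from False have "CARD('a) ^ D \<le> card (block_ker {a..<a + T} {a - w..<a - w + T} f)"
      "CARD('a) ^ D \<le> card (block_ker {a + T..<a + 2 * T} {a + T + w..<a + 2 * T + w} f)"
      by simp_all
    from glue_kernels[OF f' \<open>w \<le> a\<close> \<open>s < 2 * D\<close> this]
    obtain v where v: "v \<noteq> (\<lambda>_. 0)" "v \<in> block_ker ?C (- ?Rb) f" by blast
    have "card ?Rb \<le> 2 * w + 1 - 2 * D"
      using \<open>w \<le> a\<close> by (simp add: s_def)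
    then have "CARD('a) ^ card ?Rb \<le> CARD('a) ^ (2 * w + 1 - 2 * D)"
      using q by (intro power_increasing) simp_all
    then have "?p \<le> 1 / real (CARD('a) ^ card ?Rb)"
      by (intro divide_left_mono of_nat_mono) simp_all
    also have "\<dots> \<le> avg ?FB (\<lambda>g. of_bool (\<forall>r\<in>?Rb. (\<Sum>j\<in>?C. g (r, j) * v j) = 0))"
      by (intro avg_rows_annihilate_vector AB(3)) simp
    also have "\<dots> \<le> avg ?FB (\<lambda>g. of_bool (has_block_kernel ?C (\<lambda>x. f x + g x)))"
    proof (rule avg_mono)
      fix g assume g: "g \<in> ?FB"
      have "has_block_kernel ?C (\<lambda>x. f x + g x)"
        if kill: "\<forall>r\<in>?Rb. (\<Sum>j\<in>?C. g (r, j) * v j) = 0"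
      proof -
        have "(\<Sum>j\<in>?C. (f (r, j) + g (r, j)) * v j) = 0" for r
        proof (cases "r \<in> ?Rb")
          case True
          then have "f (r, j) = 0" for j using f by (simp add: funs_on_def A_def B_def)
          then show ?thesis using kill True by simp
        next
          case out: False
          then have "g (r, j) = 0" for j using g unfolding funs_on_def B_def by simp
          then show ?thesis using v(2) out unfolding block_ker_def by simp
        qed
        then have "v \<in> block_ker ?C UNIV (\<lambda>x. f x + g x)"
          using v(2) unfolding block_ker_def by simp
        with v(1) show ?thesis unfolding has_block_kernel_def by blast
      qed
      then show "of_bool (\<forall>r\<in>?Rb. (\<Sum>j\<in>?C. g (r, j) * v j) = 0)
          \<le> (of_bool (has_block_kernel ?C (\<lambda>x. f x + g x)) :: real)"
        by (auto simp only: of_bool_def split: if_split)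
    qed
    finally show ?thesis using False by simp
  qed
  have "1 / 2 \<le> 1 - avg ?FA (\<lambda>f. of_bool (?lowL f)) - avg ?FA (\<lambda>f. of_bool (?lowR f))"
    using lowL lowR by linarith
  also have "\<dots> = avg ?FA (\<lambda>f. 1 - of_bool (?lowL f) - of_bool (?lowR f))"
    using card_funs_on_pos[OF AB(2), where 'a = 'a]
    unfolding avg_def sum_subtractf diff_divide_distrib by simp
  finally have "1 / 2 * ?p \<le> avg ?FA (\<lambda>f. 1 - of_bool (?lowL f) - of_bool (?lowR f)) * ?p"
    using p0 by (rule mult_right_mono)
  also have "\<dots> = avg ?FA (\<lambda>f. (1 - of_bool (?lowL f) - of_bool (?lowR f)) * ?p)"
    by (rule avg_multc[symmetric])
  also have "\<dots> \<le> avg ?FA (\<lambda>f. avg ?FB (\<lambda>g. of_bool (has_block_kernel ?C (\<lambda>x. f x + g x))))"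
    by (rule avg_mono) (rule inner)
  also have "\<dots> = avg (funs_on P) (\<lambda>f :: _ \<Rightarrow> 'a. of_bool (has_block_kernel ?C f))"
    using avg_funs_on_Un[OF AB(2-4), of "\<lambda>f :: _ \<Rightarrow> 'a. of_bool (has_block_kernel ?C f)"]
    unfolding AB(1) by (rule sym)
  finally show ?thesis .
qed

lemma avg_has_block_kernels:
  fixes C :: "'k \<Rightarrow> nat set" and x :: real
  assumes "finite I" "disjoint_family_on C I" "0 \<le> x"
    and "\<And>i P. i \<in> I \<Longrightarrow> finite P \<Longrightarrow> P \<subseteq> band w \<Longrightarrow>
      x \<le> avg (funs_on P) (\<lambda>f :: _ \<Rightarrow> 'a::{field,finite}. of_bool (has_block_kernel (C i) f))"
    and "finite P" "P \<subseteq> band w"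
  shows "x ^ card I
    \<le> avg (funs_on P) (\<lambda>f :: _ \<Rightarrow> 'a. of_bool (\<forall>i\<in>I. has_block_kernel (C i) f))"
  using assms
proof (induction I arbitrary: P rule: finite_induct)
  case empty
  then show ?case using avg_const[OF card_funs_on_pos[OF empty.prems(4), where 'a = 'a], of 1] by simp
next
  case (insert i I)
  define B where "B = {p\<in>P. snd p \<in> C i}"
  define A where "A = P - B"
  have AB: "A \<union> B = P" "finite A" "finite B" "A \<inter> B = {}" "A \<subseteq> band w" "B \<subseteq> band w"
    using insert.prems(4,5) by (auto simp: A_def B_def)
  let ?E = "\<lambda>f. \<forall>i\<in>I. has_block_kernel (C i) f"
  have IH: "x ^ card I \<le> avg (funs_on A) (\<lambda>f :: _ \<Rightarrow> 'a. of_bool (?E f))"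
  proof (rule insert.IH)
    show "disjoint_family_on C I" using insert.prems(1) by (rule disjoint_family_on_mono[rotated]) auto
    fix k P' assume "k \<in> I" "finite P'" "P' \<subseteq> band w"
    then show "x \<le> avg (funs_on P') (\<lambda>f :: _ \<Rightarrow> 'a. of_bool (has_block_kernel (C k) f))"
      by (intro insert.prems(3)) auto
  qed (use insert.prems(2) AB in auto)
  have Bi: "x \<le> avg (funs_on B) (\<lambda>f :: _ \<Rightarrow> 'a. of_bool (has_block_kernel (C i) f))"
    by (rule insert.prems(3)) (use AB in auto)
  have split: "has_block_kernel (C i) (\<lambda>x. f x + g x) \<longleftrightarrow> has_block_kernel (C i) g"
    "?E (\<lambda>x. f x + g x) \<longleftrightarrow> ?E f"
    if f: "f \<in> funs_on A" and g: "g \<in> funs_on B" for f g :: "nat \<times> nat \<Rightarrow> 'a"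
  proof -
    have "f (r, j) = 0" if "j \<in> C i" for r j
      using f that unfolding funs_on_def A_def B_def by simp
    then have "block_ker (C i) UNIV (\<lambda>x. f x + g x) = block_ker (C i) UNIV g"
      by (intro block_ker_cong) simp
    then show "has_block_kernel (C i) (\<lambda>x. f x + g x) \<longleftrightarrow> has_block_kernel (C i) g"
      unfolding has_block_kernel_def by simp
    have "block_ker (C k) UNIV (\<lambda>x. f x + g x) = block_ker (C k) UNIV f" if k: "k \<in> I" for k
    proof -
      have "C k \<inter> C i = {}"
        using insert.prems(1) insert.hyps(2) k unfolding disjoint_family_on_def by auto
      then have "g (r, j) = 0" if "j \<in> C k" for r j
        using g that unfolding funs_on_def B_def by auto
      then show ?thesis by (intro block_ker_cong) simp
    qed
    then show "?E (\<lambda>x. f x + g x) \<longleftrightarrow> ?E f"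
      unfolding has_block_kernel_def by simp
  qed
  have "x ^ card (insert i I) = x ^ card I * x"
    using insert.hyps by simp
  also have "\<dots> \<le> avg (funs_on A) (\<lambda>f :: _ \<Rightarrow> 'a. of_bool (?E f)) *
      avg (funs_on B) (\<lambda>g :: _ \<Rightarrow> 'a. of_bool (has_block_kernel (C i) g))"
    using insert.prems(2) by (intro mult_mono IH Bi order_trans[OF zero_le_power IH])
  also have "\<dots> = avg (funs_on A) (\<lambda>f :: _ \<Rightarrow> 'a. avg (funs_on B)
      (\<lambda>g :: _ \<Rightarrow> 'a. of_bool (?E f) * of_bool (has_block_kernel (C i) g)))"
    unfolding avg_cmult avg_multc ..
  also have "\<dots> \<le> avg (funs_on A) (\<lambda>f :: _ \<Rightarrow> 'a. avg (funs_on B)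
      (\<lambda>g :: _ \<Rightarrow> 'a. of_bool (\<forall>k\<in>insert i I. has_block_kernel (C k) (\<lambda>x. f x + g x))))"
    by (rule avg_mono, rule avg_mono) (simp add: split)
  also have "\<dots> = avg (funs_on P) (\<lambda>f :: _ \<Rightarrow> 'a. of_bool (\<forall>k\<in>insert i I. has_block_kernel (C k) f))"
    using avg_funs_on_Un[OF AB(2-4), of "\<lambda>f :: _ \<Rightarrow> 'a. of_bool (\<forall>k\<in>insert i I. has_block_kernel (C k) f)"]
    unfolding AB(1) by (rule sym)
  finally show ?case .
qed

section \<open>Random band matrices\<close>

lemma bij_betw_band_mats:
  "bij_betw (mat n n) (funs_on ({..<n} \<times> {..<n} \<inter> band w)) (band_mats n w :: 'a::zero mat set)"
proof (rule bij_betwI[where g = "\<lambda>A (i, j). if i < n \<and> j < n then A $$ (i, j) else 0"], goal_cases)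
  case 1
  have "f (i, j) = 0" if "f \<in> funs_on ({..<n} \<times> {..<n} \<inter> band w)" "int w < \<bar>int i - int j\<bar>"
    for f :: "nat \<times> nat \<Rightarrow> 'a" and i j
  proof -
    have "(i, j) \<notin> band w" using that(2) unfolding band_def by auto
    then show ?thesis using that(1) unfolding funs_on_def by blast
  qed
  then show ?case by (auto simp: band_mats_def)
next
  case 2
  show ?case
    by (auto simp: band_mats_def band_def funs_on_def split: if_splits)
next
  case (3 f)
  then show ?case by (auto simp: funs_on_def fun_eq_iff)
next
  case (4 A)
  then show ?case by (intro eq_matI) (auto simp: band_mats_def)
qed

lemma prob_random_band_mat:
  "measure_pmf.prob (random_band_mat n w) {A :: 'a::{zero,finite} mat. Q A} =
    avg (funs_on ({..<n} \<times> {..<n} \<inter> band w)) (\<lambda>f. of_bool (Q (mat n n f)))"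
proof -
  let ?F = "funs_on ({..<n} \<times> {..<n} \<inter> band w) :: (nat \<times> nat \<Rightarrow> 'a) set"
  have fin: "finite ?F" by (intro finite_funs_on) auto
  have card: "card ?F = card (band_mats n w :: 'a mat set)"
    using bij_betw_same_card[OF bij_betw_band_mats] .
  have inj: "inj_on (mat n n) ?F" and im: "mat n n ` ?F = band_mats n w"
    using bij_betw_band_mats[of n w, where 'a = 'a] unfolding bij_betw_def by auto
  have "band_mats n w \<inter> {A. Q A} = mat n n ` {f\<in>?F. Q (mat n n f)}"
    unfolding im[symmetric] by blast
  then have "card (band_mats n w \<inter> {A. Q A}) = card {f\<in>?F. Q (mat n n f)}"
    using inj by (simp add: card_image inj_on_subset)
  then show ?thesis
    unfolding random_band_mat_def avg_of_bool[OF fin] card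
    by (simp add: measure_pmf_of_set[OF band_mats_nonempty finite_band_mats])
qed

lemma localized_kernel_mat:
  fixes f :: "nat \<times> nat \<Rightarrow> 'a::field"
  assumes "\<And>i. i \<in> {1..L} \<Longrightarrow> has_block_kernel {(i - 1) * (n div L)..<i * (n div L)} f"
  shows "localized_kernel n L (mat n n f)"
  unfolding localized_kernel_def
proof
  fix i assume i: "i \<in> {1..L}"
  let ?C = "{(i - 1) * (n div L)..<i * (n div L)}"
  from assms[OF i] obtain v where v: "v \<in> block_ker ?C UNIV f" "v \<noteq> (\<lambda>_. 0)"
    unfolding has_block_kernel_def by blast
  have "i * (n div L) \<le> L * (n div L)" using i by simp
  also have "\<dots> \<le> n" by simp
  finally have sub: "?C \<subseteq> {..<n}" by auto
  have v0: "v j = 0" if "j \<notin> ?C" for j using v(1) that unfolding block_ker_def funs_on_def by blast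
  from v(2) obtain j where j: "v j \<noteq> 0" by auto
  then have "j \<in> ?C" using v0[of j] by blast
  then have "j \<in> supp_vec (vec n v)" using j sub by (auto simp: supp_vec_def)
  moreover have "supp_vec (vec n v) \<subseteq> ?C"
  proof
    fix j assume "j \<in> supp_vec (vec n v)"
    then have "v j \<noteq> 0" by (auto simp: supp_vec_def)
    then show "j \<in> ?C" using v0[of j] by blast
  qed
  ultimately have "vec n v \<in> block_vecs n L i" unfolding block_vecs_def
    by (intro CollectI conjI vec_carrier) auto
  moreover have "mat n n f *\<^sub>v vec n v = 0\<^sub>v n"
  proof (rule eq_vecI)
    fix r assume "r < dim_vec (0\<^sub>v n :: 'a Matrix.vec)"
    then have r: "r < n" by simp
    have "(mat n n f *\<^sub>v vec n v) $ r = (\<Sum>j\<in>{0..<n}. f (r, j) * v j)"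
      using r by (simp add: scalar_prod_def)
    also have "\<dots> = (\<Sum>j\<in>?C. f (r, j) * v j)"
    proof (rule sum.mono_neutral_right)
      show "\<forall>j\<in>{0..<n} - ?C. f (r, j) * v j = 0"
      proof
        fix j assume "j \<in> {0..<n} - ?C"
        then show "f (r, j) * v j = 0" using v0[of j] by simp
      qed
      show "?C \<subseteq> {0..<n}" using sub unfolding lessThan_atLeast0 .
    qed simp
    also have "\<dots> = 0" using v(1) unfolding block_ker_def by blast
    finally show "(mat n n f *\<^sub>v vec n v) $ r = 0\<^sub>v n $ r" using r by simp
  qed simp
  ultimately show "\<exists>v\<in>block_vecs n L i. mat n n f *\<^sub>v v = 0\<^sub>v n" by blast
qed

lemma block_index_unique:
  fixes i k m j :: nat
  assumes "j \<in> {(i - 1) * m..<i * m}" "j \<in> {(k - 1) * m..<k * m}"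
  shows "i = k"
proof -
  have "(i - 1) * m < k * m" "(k - 1) * m < i * m"
    using assms by (simp_all only: atLeastLessThan_iff) linarith+
  then have "i - 1 < k" "k - 1 < i" by simp_all
  then show ?thesis using assms by (cases i; cases k) auto
qed

lemma block_vecs_disjoint:
  assumes "v \<in> block_vecs n L i" "u \<in> block_vecs n L k" "j \<in> supp_vec v" "j \<in> supp_vec u"
  shows "i = k"
proof (rule block_index_unique)
  show "j \<in> {(i - 1) * (n div L)..<i * (n div L)}" "j \<in> {(k - 1) * (n div L)..<k * (n div L)}"
    using assms unfolding block_vecs_def by blast+
qed

lemma localized_kernel_imp_kernel_dim:
  fixes A :: "'a::field mat"
  assumes A: "A \<in> carrier_mat n n" and "localized_kernel n L A"
  shows "L \<le> kernel_dim A"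
proof -
  from assms(2) obtain v where v: "\<And>i. i \<in> {1..L} \<Longrightarrow> v i \<in> block_vecs n L i"
    "\<And>i. i \<in> {1..L} \<Longrightarrow> A *\<^sub>v v i = 0\<^sub>v n"
    unfolding localized_kernel_def by metis
  interpret kernel n n A by unfold_locales (rule A)
  have "\<exists>j. j \<in> supp_vec (v i)" if "i \<in> {1..L}" for i
    using v(1)[OF that] unfolding block_vecs_def by blast
  then obtain s where s: "\<And>i. i \<in> {1..L} \<Longrightarrow> s i \<in> supp_vec (v i)" by metis
  have dim: "v i \<in> carrier_vec n" if "i \<in> {1..L}" for i
    using v(1)[OF that] unfolding block_vecs_def by blast
  have s_n: "s i < n" "v i $ s i \<noteq> 0" if "i \<in> {1..L}" for i
    using s[OF that] dim[OF that] unfolding supp_vec_def by auto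
  have off: "v k $ s i = 0" if "i \<in> {1..L}" "k \<in> {1..L}" "k \<noteq> i" for i k
  proof (rule ccontr)
    assume "v k $ s i \<noteq> 0"
    then have "s i \<in> supp_vec (v k)"
      using s_n(1)[OF that(1)] dim[OF that(2)] unfolding supp_vec_def by auto
    from block_vecs_disjoint[OF v(1)[OF that(2)] v(1)[OF that(1)] this s[OF that(1)]] that(3)
    show False by simp
  qed
  have inj: "inj_on v {1..L}"
  proof (rule inj_onI, rule ccontr)
    fix i k assume "i \<in> {1..L}" "k \<in> {1..L}" "v i = v k" "i \<noteq> k"
    then show False using off[of i k] s_n(2)[of i] by simp
  qed
  let ?S = "v ` {1..L}"
  have S: "?S \<subseteq> mat_kernel A" using v(2) dim by (auto intro: mat_kernelI[OF A])
  have zero: "a (v i) = 0" if a: "lincomb a ?S = 0\<^sub>v n" and i: "i \<in> {1..L}" for a i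
  proof -
    have "0 = (\<Sum>x\<in>?S. a x * x $ s i)"
      using lincomb_index[OF s_n(1)[OF i] S, of a] s_n(1)[OF i] unfolding a by simp
    also have "\<dots> = (\<Sum>k\<in>{1..L}. a (v k) * v k $ s i)"
      unfolding sum.reindex[OF inj] o_def ..
    also have "\<dots> = (\<Sum>k\<in>{i}. a (v k) * v k $ s i)"
      using i off by (intro sum.mono_neutral_right) auto
    finally show ?thesis using s_n(2)[OF i] by simp
  qed
  have "finite ?S" by simp
  have "Ker.lin_indpt ?S"
    by (intro Ker.finite_lin_indpt2[OF \<open>finite ?S\<close>])
       (use S zero in \<open>auto simp: class_field_def\<close>)
  moreover obtain Bs where Bs: "finite Bs" "basis Bs" using kernel_basis_exists[OF A] by blast
  then have "Ker.fin_dim" unfolding Ker.fin_dim_def Ker.basis_def by auto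
  ultimately have "card ?S \<le> dim"
    using S by (intro Ker.li_le_dim(2)) auto
  then show ?thesis unfolding card_image[OF inj] by simp
qed

lemma prob_localized_le_kernel_dim:
  "measure_pmf.prob (random_band_mat n w) {A :: 'a::{field,finite} mat. localized_kernel n L A}
    \<le> measure_pmf.prob (random_band_mat n w) {A :: 'a mat. L \<le> kernel_dim A}"
  unfolding prob_random_band_mat
proof (rule avg_mono)
  fix f :: "nat \<times> nat \<Rightarrow> 'a"
  have "L \<le> kernel_dim (mat n n f)" if "localized_kernel n L (mat n n f)"
    using localized_kernel_imp_kernel_dim[OF _ that] by simp
  then show "of_bool (localized_kernel n L (mat n n f)) \<le> (of_bool (L \<le> kernel_dim (mat n n f)) :: real)"
    by (simp only: of_bool_def split: if_split) simp
qed

lemma has_block_kernel_mono: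
  assumes "has_block_kernel C f" "finite C'" "C \<subseteq> C'"
  shows "has_block_kernel C' f"
  using assms(1) block_ker_mono_columns[OF assms(2,3), of UNIV f] unfolding has_block_kernel_def by blast

lemma prob_localized_kernel_ge:
  assumes "1 \<le> D" "8 * CARD('a) ^ D \<le> T" "2 * T + w \<le> n div L"
  shows "(1 / 2 * (1 / real (CARD('a) ^ (2 * w + 1 - 2 * D)))) ^ L
    \<le> measure_pmf.prob (random_band_mat n w) {A :: 'a::{field,finite} mat. localized_kernel n L A}"
proof -
  define x where "x = 1 / 2 * (1 / real (CARD('a) ^ (2 * w + 1 - 2 * D)))"
  define C where "C i = {(i - 1) * (n div L)..<i * (n div L)}" for i
  have block: "x \<le> avg (funs_on P) (\<lambda>f :: _ \<Rightarrow> 'a. of_bool (has_block_kernel (C i) f))"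
    if i: "i \<in> {1..L}" and P: "finite P" "P \<subseteq> band w" for i P
  proof -
    define a where "a = (i - 1) * (n div L) + w"
    have "w \<le> a" by (simp add: a_def)
    have "i * (n div L) = (i - 1) * (n div L) + n div L"
      using i by (cases i) simp_all
    then have "{a..<a + 2 * T} \<subseteq> C i" unfolding C_def a_def using assms(3) by auto
    then have mono: "has_block_kernel (C i) f" if "has_block_kernel {a..<a + 2 * T} f" for f :: "_ \<Rightarrow> 'a"
      using that by (intro has_block_kernel_mono[OF that]) (simp_all add: C_def)
    have "x \<le> avg (funs_on P) (\<lambda>f :: _ \<Rightarrow> 'a. of_bool (has_block_kernel {a..<a + 2 * T} f))"
      unfolding x_def by (rule avg_has_block_kernel[OF P \<open>w \<le> a\<close> assms(1,2)])
    also have "\<dots> \<le> avg (funs_on P) (\<lambda>f :: _ \<Rightarrow> 'a. of_bool (has_block_kernel (C i) f))"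
      using mono by (intro avg_mono) simp
    finally show ?thesis .
  qed
  have "disjoint_family_on C {1..L}"
    unfolding disjoint_family_on_def C_def using block_index_unique by blast
  then have "x ^ card {1..L} \<le> avg (funs_on ({..<n} \<times> {..<n} \<inter> band w))
      (\<lambda>f :: _ \<Rightarrow> 'a. of_bool (\<forall>i\<in>{1..L}. has_block_kernel (C i) f))"
    by (intro avg_has_block_kernels[where w = w] block) (simp_all add: x_def)
  also have "\<dots> \<le> avg (funs_on ({..<n} \<times> {..<n} \<inter> band w))
      (\<lambda>f :: _ \<Rightarrow> 'a. of_bool (localized_kernel n L (mat n n f)))"
  proof (rule avg_mono)
    fix f :: "nat \<times> nat \<Rightarrow> 'a"
    have "localized_kernel n L (mat n n f)" if "\<forall>i\<in>{1..L}. has_block_kernel (C i) f"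
      by (rule localized_kernel_mat) (use that in \<open>simp add: C_def\<close>)
    then show "of_bool (\<forall>i\<in>{1..L}. has_block_kernel (C i) f)
        \<le> (of_bool (localized_kernel n L (mat n n f)) :: real)"
      by (simp only: of_bool_def split: if_split) simp
  qed
  finally show ?thesis unfolding prob_random_band_mat x_def by simp
qed

lemma square_ratio_bound:
  fixes q K l u v :: real
  assumes "1 \<le> q" "0 \<le> K" "0 < l" "0 < u" "0 < v" "v \<le> 64 * K * q * l * u"
  shows "(1 / (128 * q\<^sup>2 * (K + 1)) / l)\<^sup>2 \<le> u\<^sup>2 / (2 * q * v\<^sup>2)"
proof -
  define x where "x = 1 / (128 * q\<^sup>2 * (K + 1)) / l"
  have x: "0 \<le> x" using assms by (simp add: x_def)
  have "x * v \<le> x * (64 * K * q * l * u)" using assms(6) x by (rule mult_left_mono)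
  also have "\<dots> = u / (2 * q) * (K / (K + 1))"
  proof -
    have "1 / (128 * q\<^sup>2 * c) / l * (64 * K * q * l * u) = u / (2 * q) * (K / c)" if "0 < c" for c
      using assms that by (simp add: field_simps power2_eq_square)
    then show ?thesis unfolding x_def using assms(2) by simp
  qed
  also have "\<dots> \<le> u / (2 * q) * 1" using assms by (intro mult_left_mono) simp_all
  finally have "(x * v)\<^sup>2 \<le> (u / (2 * q))\<^sup>2" using x assms by (intro power_mono) simp_all
  also have "\<dots> = u\<^sup>2 / (2 * q) / (2 * q)" by (simp add: power2_eq_square)
  also have "\<dots> \<le> u\<^sup>2 / (2 * q) / 1" using assms by (intro divide_left_mono) simp_all
  finally have "x\<^sup>2 * v\<^sup>2 \<le> u\<^sup>2 / (2 * q)" by (simp add: power_mult_distrib)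
  then have "x\<^sup>2 \<le> u\<^sup>2 / (2 * q) / v\<^sup>2" using assms by (simp add: pos_le_divide_eq mult_ac)
  then show ?thesis unfolding x_def by simp
qed

lemma prob_localized_kernel_bound:
  fixes K :: real
  defines "q \<equiv> real CARD('a::{field,finite})"
  assumes L: "1 \<le> L" and n: "64 * q * L \<le> n" and w: "w \<le> n / (4 * L)" and K: "q ^ w \<le> K * n"
  shows "(1 / (128 * q\<^sup>2 * (K + 1)) / L) ^ (4 * L)
    \<le> measure_pmf.prob (random_band_mat n w) {A :: 'a mat. localized_kernel n L A}"
proof -
  have card: "2 \<le> CARD('a)"
    using card_mono[of "UNIV :: 'a set" "{0, 1}"] by simp
  then have q: "2 \<le> q" by (simp add: q_def)
  have l: "1 \<le> real L" using L by simp
  have n0: "0 < real n"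
    using q l by (intro less_le_trans[OF _ n]) simp
  have K0: "0 < K"
    using q n0 by (intro zero_less_mult_pos2[OF less_le_trans[OF _ K] n0]) simp
  define N where "N = real n / real L"
  define m where "m = n div L"
  have m: "N - 1 < m"
  proof -
    have "n < L * (m + 1)"
      using L dividend_less_times_div[of L n] by (simp add: m_def)
    then have "real n < real (L * (m + 1))" by (simp only: of_nat_less_iff)
    then have "real n < real L * (real m + 1)" by (simp add: distrib_left)
    then show ?thesis using l by (simp add: N_def field_simps)
  qed
  define T where "T = (m - w) div 2"
  have nL: "64 * q \<le> N" using n l by (simp add: N_def field_simps)
  have w': "w \<le> N / 4" using w by (simp add: N_def field_simps)
  have "real w \<le> real m" using m w' nL q by linarith
  then have "w \<le> m" by simp
  then have Tm: "2 * T + w \<le> n div L" unfolding T_def m_def by linarith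
  have "m \<le> 2 * T + 1 + w" unfolding T_def by linarith
  then have "real m \<le> real (2 * T + 1 + w)" by (simp only: of_nat_le_iff)
  then have "real m - real w \<le> 2 * real T + 1" by simp
  then have T: "N / 8 \<le> T" using m w' nL q by linarith
  then have "8 * q \<le> T" using nL by linarith
  then have "real (8 * CARD('a)) \<le> real T" by (simp add: q_def)
  then have "8 * CARD('a) \<le> T" by (simp only: of_nat_le_iff)
  then have T8: "CARD('a) \<le> T div 8" by linarith
  then have "1 \<le> T div 8" using card by linarith
  from ex_power_ivl1[OF card this] obtain D where
    D: "CARD('a) ^ D \<le> T div 8" "T div 8 < CARD('a) ^ (D + 1)" by blast
  have "CARD('a) ^ 1 < CARD('a) ^ (D + 1)"
    using le_less_trans[OF T8 D(2)] by (simp only: power_one_right)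
  from power_less_imp_less_exp[OF _ this] have D1: "1 \<le> D" using card by simp
  have DT: "8 * CARD('a) ^ D \<le> T" using D(1) by linarith
  have "T < 8 * CARD('a) ^ (D + 1)" using D(2) by linarith
  then have "real T < real (8 * CARD('a) ^ (D + 1))" by (simp only: of_nat_less_iff)
  then have "real T < 8 * q ^ (D + 1)" by (simp add: q_def)
  with T have "N / 8 \<le> 8 * q ^ (D + 1)" by linarith
  then have nD: "n \<le> 64 * q * L * q ^ D" using l by (simp add: N_def field_simps)
  define x where "x = 1 / (128 * q\<^sup>2 * (K + 1)) / L"
  define y where "y = 1 / 2 * (1 / real (CARD('a) ^ (2 * w + 1 - 2 * D)))"
  have x0: "0 \<le> x" using K0 l by (simp add: x_def)
  have "1 \<le> q\<^sup>2" using q by simp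
  then have "128 * 1 * 1 \<le> 128 * q\<^sup>2 * (K + 1)"
    using K0 by (intro mult_mono) simp_all
  then have "1 / (128 * q\<^sup>2 * (K + 1)) \<le> 1 / 128" by (intro divide_left_mono) simp_all
  moreover have "x \<le> 1 / (128 * q\<^sup>2 * (K + 1)) / 1"
    unfolding x_def using l K0 by (intro divide_left_mono) simp_all
  ultimately have x2: "x \<le> 1 / 2" by linarith
  have xy: "x\<^sup>2 \<le> y"
  proof (cases "2 * w + 1 \<le> 2 * D")
    case True
    then have "y = 1 / 2" by (simp add: y_def)
    moreover have "x\<^sup>2 \<le> x" using x0 x2 by (simp add: power2_eq_square mult_left_le)
    ultimately show ?thesis using x2 by simp
  next
    case False
    have "q ^ w \<le> 64 * K * q * L * q ^ D"
    proof -
      have "K * n \<le> K * (64 * q * L * q ^ D)" using nD K0 by (intro mult_left_mono) simp_all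
      then show ?thesis using K by (simp add: mult_ac)
    qed
    then have "x\<^sup>2 \<le> (q ^ D)\<^sup>2 / (2 * q * (q ^ w)\<^sup>2)"
      unfolding x_def using q K0 l by (intro square_ratio_bound) simp_all
    also have "\<dots> = y"
    proof -
      have "q * (q ^ w)\<^sup>2 = q ^ (2 * w + 1 - 2 * D) * (q ^ D)\<^sup>2"
      proof -
        have "q ^ (2 * w + 1 - 2 * D) * (q ^ D)\<^sup>2 = q ^ (2 * w + 1 - 2 * D + 2 * D)"
          unfolding power_add power_even_eq ..
        also have "2 * w + 1 - 2 * D + 2 * D = 2 * w + 1" using False by simp
        also have "q ^ (2 * w + 1) = q * (q ^ w)\<^sup>2" by (simp add: power_even_eq)
        finally show ?thesis by (rule sym)
      qed
      then have "2 * q * (q ^ w)\<^sup>2 = 2 * (q ^ (2 * w + 1 - 2 * D) * (q ^ D)\<^sup>2)" by simp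
      moreover have "0 < q ^ D" using q by simp
      moreover have "u\<^sup>2 / (2 * (c * u\<^sup>2)) = 1 / 2 * (1 / c)" if "0 < u" for u c :: real
        using that by simp
      ultimately show ?thesis unfolding y_def of_nat_power q_def[symmetric] by metis
    qed
    finally show ?thesis .
  qed
  have "x ^ 4 \<le> x\<^sup>2" using x0 x2 by (intro power_decreasing) simp_all
  with xy have "x ^ 4 \<le> y" by linarith
  then have "(x ^ 4) ^ L \<le> y ^ L" using x0 by (intro power_mono) simp_all
  also have "\<dots> \<le> measure_pmf.prob (random_band_mat n w) {A :: 'a mat. localized_kernel n L A}"
    unfolding y_def by (rule prob_localized_kernel_ge[OF D1 DT Tm])
  finally show ?thesis unfolding x_def power_mult .
qed

theorem theorem3:
  fixes w :: "nat \<Rightarrow> nat"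
    and B :: "nat \<Rightarrow> 'p::prime_card mod_ring mat pmf"
  assumes "\<And>n. n \<ge> 1 \<Longrightarrow> w n > 0"
    and "\<not> filterlim (\<lambda>n. real (w n) - log (real CARD('p)) (real n)) at_top sequentially"
    and "\<And>n. n \<ge> 1 \<Longrightarrow> B n = random_band_mat n (w n)"
  shows "\<exists>\<kappa>>0.
    (\<forall>L\<ge>1. infinite {n. n \<ge> 1 \<and>
       measure_pmf.prob (B n) {A. localized_kernel n L A} \<ge> (\<kappa> / real L) ^ (4 * L)}) \<and>
    (\<forall>L\<ge>1. infinite {n. n \<ge> 1 \<and>
       measure_pmf.prob (B n) {A. kernel_dim A \<ge> L} \<ge> (\<kappa> / real L) ^ (4 * L)})"
proof -
  let ?q = "real CARD('p)"
  have q: "CARD('p mod_ring) = CARD('p)" by simp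
  have q1: "1 < ?q" using prime_gt_1_nat[OF prime_card[where 'a = 'p]] by simp
  obtain Z where Z: "\<exists>\<^sub>F n in sequentially. real (w n) - log ?q (real n) < Z"
    using assms(2) unfolding filterlim_at_top by (auto simp: not_eventually not_le)
  define K where "K = ?q powr Z"
  have K: "0 < K" using q1 by (simp add: K_def)
  define \<kappa> where "\<kappa> = 1 / (128 * ?q\<^sup>2 * (K + 1))"
  have \<kappa>: "0 < \<kappa>" using K q1 by (simp add: \<kappa>_def)
  have main: "infinite {n. n \<ge> 1 \<and>
       measure_pmf.prob (B n) {A. localized_kernel n L A} \<ge> (\<kappa> / real L) ^ (4 * L)}" if L: "L \<ge> 1" for L
  proof -
    have "eventually (\<lambda>n. log ?q (real n) + Z \<le> n / (4 * L)) sequentially"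
      using q1 L by real_asymp
    moreover have "eventually (\<lambda>n. 64 * ?q * L \<le> real n) sequentially"
      by real_asymp
    ultimately have ev: "eventually (\<lambda>n. log ?q (real n) + Z \<le> n / (4 * L) \<and> 64 * ?q * L \<le> real n \<and> 1 \<le> n) sequentially"
      using eventually_ge_at_top[of "1::nat"] by eventually_elim simp
    have "\<exists>\<^sub>F n in sequentially. n \<ge> 1 \<and>
       measure_pmf.prob (B n) {A. localized_kernel n L A} \<ge> (\<kappa> / real L) ^ (4 * L)"
      using frequently_eventually_frequently[OF Z ev]
    proof (rule frequently_elim1, elim conjE, intro conjI)
      fix n :: nat
      assume n: "real (w n) - log ?q (real n) < Z" "log ?q (real n) + Z \<le> n / (4 * L)"
        "64 * ?q * L \<le> real n" "1 \<le> n"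
      have "?q ^ w n = ?q powr w n" using q1 by (simp add: powr_realpow)
      also have "\<dots> \<le> ?q powr (log ?q n + Z)" using n(1) q1 by (intro powr_mono) simp_all
      also have "\<dots> = K * n" using q1 n(4) by (simp add: powr_add K_def)
      finally have "?q ^ w n \<le> K * n" .
      moreover have "w n \<le> n / (4 * L)" using n(1,2) by linarith
      ultimately show "(\<kappa> / real L) ^ (4 * L) \<le> measure_pmf.prob (B n) {A. localized_kernel n L A}"
        unfolding assms(3)[OF n(4)] \<kappa>_def
        using prob_localized_kernel_bound[where 'a = "'p mod_ring", of L n "w n" K, unfolded q] L n(3) by blast
    qed
    then show ?thesis by (simp add: frequently_cofinite flip: cofinite_eq_sequentially)
  qed
  have "infinite {n. n \<ge> 1 \<and>
       measure_pmf.prob (B n) {A. kernel_dim A \<ge> L} \<ge> (\<kappa> / real L) ^ (4 * L)}" if L: "L \<ge> 1" for L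
  proof (rule infinite_super[OF _ main[OF L]], intro subsetI CollectI, elim CollectE conjE, intro conjI)
    fix n assume n: "1 \<le> n" "(\<kappa> / real L) ^ (4 * L) \<le> measure_pmf.prob (B n) {A. localized_kernel n L A}"
    note n(2)
    also have "measure_pmf.prob (B n) {A. localized_kernel n L A} \<le> measure_pmf.prob (B n) {A. kernel_dim A \<ge> L}"
      unfolding assms(3)[OF n(1)] by (rule prob_localized_le_kernel_dim)
    finally show "(\<kappa> / real L) ^ (4 * L) \<le> measure_pmf.prob (B n) {A. kernel_dim A \<ge> L}" .
  qed
  with main \<kappa> show ?thesis by blast
qed

end
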